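(* Let $s>2$ be an integer, let $p_0,p_1,\dots,p_{s-1}$ be positive real numbers with $p_0+p_1+\dots+p_{s-1}=1$, and let $u\in\{0,1,\dots,s-1\}$. Then the set $\mathbb S_{(P_s,u)}$ is a self-similar fractal, and its Hausdorff dimension $\alpha_0=\alpha_0(\mathbb S_{(P_s,u)})$ satisfies the equation $$\sum_{i\in A_0\setminus\{u\}}\left(p_i\,p_u^{\,i-1}\right)^{\alpha_0}=1,$$ where $A_0=\{1,2,\dots,s-1\}$.
   Context: Let $s>2$ be an integer, $A=\{0,1,\dots,s-1\}$, $A_0=\{1,2,\dots,s-1\}$, and $P=\{p_0,\dots,p_{s-1}\}$ a fixed tuple of positive reals with sum $1$. Put $\beta_0=0$ and $\beta_k=\sum_{i=0}^{k-1}p_i$ for $k\in A_0$. For a sequence $(a_n)_{n\ge1}$ of elements of $A$, write $$\Delta^{P}_{a_1a_2\ldots a_n\ldots}=\beta_{a_1}+\sum_{n=2}^{\infty}\Big(\beta_{a_n}\prod_{j=1}^{n-1}p_{a_j}\Big)\in[0,1];$$ this is called the P-representation of the number. For fixed $u\in A$, the set $\mathbb S_{(P_s,u)}$ is $$\mathbb S_{(P_s,u)}=\Big\{x: x=\Delta^{P}_{\underbrace{u\ldots u}_{\alpha_1-1}\alpha_1\underbrace{u\ldots u}_{\alpha_2-1}\alpha_2\ldots\underbrace{u\ldots u}_{\alpha_n-1}\alpha_n\ldots},\ \alpha_n\in A_0\setminus\{u\}\text{ for all }n\ge1\Big\},$$ i.e. the digit sequence is the infinite concatenation of blocks, the $n$-th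 block consisting of $\alpha_n-1$ copies of the digit $u$ followed by the digit $\alpha_n$. "Self-similar fractal" means a nonempty compact set which is a finite union of images of itself under contracting similarities of $\mathbb R$. *)

theory Defs
  imports "HOL-Analysis.Analysis" "HOL-Library.Stream"
begin

definition beta :: "(nat \<Rightarrow> real) \<Rightarrow> nat \<Rightarrow> real" where
  "beta p k = (\<Sum>i<k. p i)"

(* Stream positions start at 0, so the term n = 0 (with empty product 1) is the
   leading summand beta_{a_1}. *)
definition P_rep :: "(nat \<Rightarrow> real) \<Rightarrow> nat stream \<Rightarrow> real" where
  "P_rep p a = (\<Sum>n. beta p (a !! n) * (\<Prod>j<n. p (a !! j)))"

definition digit_block :: "nat \<Rightarrow> nat \<Rightarrow> nat list" where
  "digit_block u k = replicate (k - 1) u @ [k]"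

definition S_set :: "nat \<Rightarrow> (nat \<Rightarrow> real) \<Rightarrow> nat \<Rightarrow> real set" where
  "S_set s p u =
     {P_rep p (flat (smap (digit_block u) \<alpha>)) | \<alpha>. \<alpha> \<in> streams ({1..<s} - {u})}"

definition contracting_similarity :: "('a::metric_space \<Rightarrow> 'a) \<Rightarrow> bool" where
  "contracting_similarity f \<longleftrightarrow>
     (\<exists>r. 0 < r \<and> r < 1 \<and> (\<forall>x y. dist (f x) (f y) = r * dist x y))"

definition self_similar_fractal :: "'a::metric_space set \<Rightarrow> bool" where
  "self_similar_fractal K \<longleftrightarrow>
     K \<noteq> {} \<and> compact K \<and>
     (\<exists>F. finite F \<and> (\<forall>f\<in>F. contracting_similarity f) \<and> K = (\<Union>f\<in>F. f ` K))"

(* diam(U)^t with the usual conventions diam({})^t = 0 and diam(U)^0 = 1 for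
   nonempty U; the latter needs its own case because 0 powr 0 = 0. *)
definition diam_pow :: "real \<Rightarrow> 'a::metric_space set \<Rightarrow> ennreal" where
  "diam_pow t U =
     (if U = {} then 0 else if t = 0 then 1 else ennreal (diameter U powr t))"

(* Boundedness must be required separately: diameter is only meaningful for
   bounded sets. *)
definition hausdorff_premeasure :: "real \<Rightarrow> real \<Rightarrow> 'a::metric_space set \<Rightarrow> ennreal" where
  "hausdorff_premeasure \<delta> t E =
     Inf {(\<Sum>n. diam_pow t (U n)) | U :: nat \<Rightarrow> 'a set.
            E \<subseteq> (\<Union>n. U n) \<and> (\<forall>n. bounded (U n) \<and> diameter (U n) \<le> \<delta>)}"

definition hausdorff_measure :: "real \<Rightarrow> 'a::metric_space set \<Rightarrow> ennreal" where
  "hausdorff_measure t E = (SUP \<delta>\<in>{0<..}. hausdorff_premeasure \<delta> t E)"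

(* Inf {} is infinity here, so a set with no null exponent has infinite dimension. *)
definition hausdorff_dim :: "'a::metric_space set \<Rightarrow> ennreal" where
  "hausdorff_dim E = Inf {ennreal t | t. 0 \<le> t \<and> hausdorff_measure t E = 0}"

end

theory Submission
  imports Defs
begin

text \<open>Prepending the block of \<open>k - 1\<close> digits \<open>u\<close> and a digit \<open>k\<close> to a digit sequence acts on
  the number represented as a contracting similarity of ratio \<open>p k * p u ^ (k - 1)\<close>. Hence the set
  is the attractor of the finite system of these maps. It is bounded, and its closure is covered by
  its own images, so every point of the closure has an address and the attractor is compact
  (\<open>subset_attractor\<close>, \<open>compact_attractor\<close>).

  Let \<open>a\<close> be an exponent at which the powers of the ratios sum to one; it exists by the
  intermediate value theorem (\<open>similarity_exponent_exists\<close>). For an exponent \<open>t > a\<close> the sum of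
  the powers is less than one, and replacing a cover by its images under the maps multiplies its
  cost by at most this sum; as the infimum of the costs is finite, it is zero
  (\<open>hausdorff_measure_attractor_eq_0\<close>).

  The lower bound rests on strong separation: the digit 0 is never the last digit of a block, so
  all points of the attractor are positive, and the images of the interval \<open>{0<..1}\<close> under the
  different maps are disjoint (\<open>block_branch_neq\<close>). Since the images of the attractor are compact
  and disjoint, they lie at a positive distance from each other, and points whose addresses first
  differ at place \<open>n\<close> (counted from 0) are at least a constant times the product of the first
  \<open>n\<close> ratios apart.
  When \<open>a > 0\<close>, read the addresses in a second system, with ratios \<open>r i powr a\<close> and branches that
  tile the unit interval. This yields a Hoelder map of exponent \<open>a\<close> from the attractor onto the
  unit interval (\<open>hoelder_surjection\<close>), and the countable subadditivity of Lebesgue measure bounds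
  the cost of every cover from below.\<close>

section \<open>Affine iterated function systems on the line\<close>

text \<open>A finite system of orientation-preserving contracting similarities
  \<open>x \<mapsto> c i + r i * x\<close> of the real line, indexed by a nonempty set of naturals.\<close>

locale affine_ifs =
  fixes I :: "nat set" and c r :: "nat \<Rightarrow> real"
  assumes finite_I: "finite I" and I_nonempty: "I \<noteq> {}"
    and ratio_pos: "i \<in> I \<Longrightarrow> 0 < r i" and ratio_less_1: "i \<in> I \<Longrightarrow> r i < 1"
begin

definition branch :: "nat \<Rightarrow> real \<Rightarrow> real" where
  "branch i x = c i + r i * x"

text \<open>The point with a given infinite address: the limit of the compositions of the branches
  along the address, written as a series.\<close>

definition coding :: "nat stream \<Rightarrow> real" where
  "coding w = (\<Sum>n. c (w !! n) * (\<Prod>j<n. r (w !! j)))"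

text \<open>The attractor is given as the set of coded points; its invariance, compactness and
  nonemptiness are derived below.\<close>

definition attractor :: "real set" where
  "attractor = coding ` streams I"

lemma dist_branch: "i \<in> I \<Longrightarrow> dist (branch i x) (branch i y) = r i * dist x y"
  using ratio_pos[of i] by (simp add: branch_def dist_real_def abs_mult flip: right_diff_distrib)

lemma contracting_similarity_branch: "i \<in> I \<Longrightarrow> contracting_similarity (branch i)"
  unfolding contracting_similarity_def using ratio_pos ratio_less_1 dist_branch by blast

lemma ratio_bound: obtains \<rho> where "0 < \<rho>" "\<rho> < 1" "\<And>i. i \<in> I \<Longrightarrow> r i \<le> \<rho>"
proof
  have "Max (r ` I) \<in> r ` I" using finite_I I_nonempty by simp
  then show "0 < Max (r ` I)" "Max (r ` I) < 1" using ratio_pos ratio_less_1 by auto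
  show "r i \<le> Max (r ` I)" if "i \<in> I" for i using that finite_I by simp
qed

lemma ratio_prod_pos: "w \<in> streams I \<Longrightarrow> 0 < (\<Prod>j<n. r (w !! j))"
  by (intro prod_pos) (auto intro: ratio_pos snth_in)

lemma ratio_prod_tendsto_0:
  assumes "w \<in> streams I"
  shows "(\<lambda>n. \<Prod>j<n. r (w !! j)) \<longlonglongrightarrow> 0"
proof -
  obtain \<rho> where \<rho>: "0 < \<rho>" "\<rho> < 1" "\<And>i. i \<in> I \<Longrightarrow> r i \<le> \<rho>" by (rule ratio_bound) blast
  have "(\<Prod>j<n. r (w !! j)) \<le> (\<Prod>j<n. \<rho>)" for n
    using assms by (intro prod_mono) (auto simp: snth_in less_imp_le ratio_pos \<rho>)
  then have "norm (\<Prod>j<n. r (w !! j)) \<le> \<rho> ^ n" for n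
    using ratio_prod_pos[OF assms, of n] by simp
  then show ?thesis
    using \<rho> by (intro Lim_null_comparison[OF _ LIMSEQ_power_zero[of \<rho>]]) auto
qed

lemma coding_term_bound:
  obtains C \<rho> where "0 < \<rho>" "\<rho> < 1"
    "\<And>w n. w \<in> streams I \<Longrightarrow> norm (c (w !! n) * (\<Prod>j<n. r (w !! j))) \<le> C * \<rho> ^ n"
proof -
  obtain \<rho> where \<rho>: "0 < \<rho>" "\<rho> < 1" "\<And>i. i \<in> I \<Longrightarrow> r i \<le> \<rho>" by (rule ratio_bound) blast
  define C where "C = Max ((\<lambda>i. \<bar>c i\<bar>) ` I)"
  have C: "\<bar>c i\<bar> \<le> C" if "i \<in> I" for i using that finite_I by (simp add: C_def)
  have "norm (c (w !! n) * (\<Prod>j<n. r (w !! j))) \<le> C * \<rho> ^ n" if w: "w \<in> streams I" for w n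
  proof -
    have "(\<Prod>j<n. r (w !! j)) \<le> (\<Prod>j<n. \<rho>)"
      using w by (intro prod_mono) (auto simp: snth_in less_imp_le ratio_pos \<rho>)
    then show ?thesis
      unfolding norm_mult using ratio_prod_pos[OF w, of n] C[OF snth_in[OF w, of n]]
      by (intro mult_mono) auto
  qed
  with \<rho> show thesis by (intro that) auto
qed

lemma coding_summable:
  assumes "w \<in> streams I"
  shows "summable (\<lambda>n. c (w !! n) * (\<Prod>j<n. r (w !! j)))"
proof -
  obtain C \<rho> where *: "0 < \<rho>" "\<rho> < 1"
    "\<And>w n. w \<in> streams I \<Longrightarrow> norm (c (w !! n) * (\<Prod>j<n. r (w !! j))) \<le> C * \<rho> ^ n"
    by (rule coding_term_bound) (rule that)
  have "summable (\<lambda>n. C * \<rho> ^ n)"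
    using * by (intro summable_mult summable_geometric) auto
  then show ?thesis using *(3)[OF assms] by (rule summable_comparison_test'[where N = 0])
qed

lemma coding_unfold:
  assumes "w \<in> streams I"
  shows "coding w = branch (shd w) (coding (stl w))"
proof -
  have w': "stl w \<in> streams I" using assms by (rule streams_stl)
  have "coding w = c (shd w) + (\<Sum>n. c (w !! Suc n) * (\<Prod>j<Suc n. r (w !! j)))"
    unfolding coding_def using suminf_split_head[OF coding_summable[OF assms]] by simp
  also have "(\<lambda>n. c (w !! Suc n) * (\<Prod>j<Suc n. r (w !! j)))
      = (\<lambda>n. r (shd w) * (c (stl w !! n) * (\<Prod>j<n. r (stl w !! j))))"
    by (simp add: prod.lessThan_Suc_shift ac_simps del: prod.lessThan_Suc)
  also have "suminf \<dots> = r (shd w) * coding (stl w)"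
    unfolding coding_def by (rule suminf_mult[OF coding_summable[OF w']])
  finally show ?thesis by (simp add: branch_def)
qed

text \<open>A bounded backward orbit along the address \<open>w\<close> must start at the point coded by \<open>w\<close>:
  it differs from the \<open>n\<close>-th partial sum of the coding series by the \<open>n\<close>-th point of the orbit
  scaled by a product of \<open>n\<close> ratios.\<close>

lemma coding_unique:
  assumes w: "w \<in> streams I" and bd: "\<And>n. \<bar>x n\<bar> \<le> M"
    and rec: "\<And>n. x n = branch (w !! n) (x (Suc n))"
  shows "x 0 = coding w"
proof -
  let ?S = "\<lambda>n. \<Sum>k<n. c (w !! k) * (\<Prod>j<k. r (w !! j))"
  let ?P = "\<lambda>n. \<Prod>j<n. r (w !! j)"
  have eq: "x 0 = ?S n + ?P n * x n" for n
  proof (induction n)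
    case (Suc n)
    then show ?case by (subst (asm) (2) rec) (simp add: branch_def algebra_simps)
  qed simp
  have "(\<lambda>n. ?P n * x n) \<longlonglongrightarrow> 0"
  proof (rule Lim_null_comparison)
    show "\<forall>\<^sub>F n in sequentially. norm (?P n * x n) \<le> ?P n * M"
      using bd less_imp_le[OF ratio_prod_pos[OF w]]
      by (intro always_eventually allI) (simp add: abs_mult mult_left_mono del: abs_prod)
    show "(\<lambda>n. ?P n * M) \<longlonglongrightarrow> 0"
      using tendsto_mult_right[OF ratio_prod_tendsto_0[OF w], of M] by simp
  qed
  then have "(\<lambda>n. x 0 - ?P n * x n) \<longlonglongrightarrow> x 0 - 0" by (intro tendsto_diff tendsto_const)
  also have "(\<lambda>n. x 0 - ?P n * x n) = ?S" by (rule ext) (simp add: diff_eq_eq eq[symmetric])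
  finally have "(\<lambda>n. c (w !! n) * ?P n) sums x 0" by (simp add: sums_def)
  then show ?thesis unfolding coding_def by (simp add: sums_iff)
qed

text \<open>A bounded set covered by its own images consists of coded points: pulling a point back
  through the branches again and again produces an address.\<close>

lemma subset_attractor:
  assumes "bounded X" and X: "X \<subseteq> (\<Union>i\<in>I. branch i ` X)"
  shows "X \<subseteq> attractor"
proof
  fix y assume y: "y \<in> X"
  have "\<forall>x\<in>X. \<exists>i z. i \<in> I \<and> z \<in> X \<and> x = branch i z" using X by blast
  then obtain d f where df: "\<And>x. x \<in> X \<Longrightarrow> d x \<in> I \<and> f x \<in> X \<and> x = branch (d x) (f x)"
    by metis
  define x where "x = (\<lambda>n. (f ^^ n) y)"
  have xX: "x n \<in> X" for n
    by (induction n) (use y df in \<open>auto simp: x_def\<close>)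
  define w where "w = smap (\<lambda>n. d (x n)) nats"
  have wn: "w !! n = d (x n)" for n by (simp add: w_def)
  then have w: "w \<in> streams I" using df xX by (auto simp: streams_iff_snth)
  obtain M where "\<And>x. x \<in> X \<Longrightarrow> \<bar>x\<bar> \<le> M" using \<open>bounded X\<close> by (auto simp: bounded_real)
  then have "\<bar>x n\<bar> \<le> M" for n using xX by blast
  moreover have "x n = branch (w !! n) (x (Suc n))" for n
    using df[OF xX[of n]] by (simp add: wn x_def)
  ultimately have "x 0 = coding w" by (rule coding_unique[OF w])
  then show "y \<in> attractor" using w by (auto simp: x_def attractor_def)
qed

lemma attractor_eq: "attractor = (\<Union>i\<in>I. branch i ` attractor)"
proof (intro equalityI subsetI)
  fix x assume "x \<in> attractor"
  then obtain w where w: "w \<in> streams I" "x = coding w" by (auto simp: attractor_def)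
  then have "x = branch (shd w) (coding (stl w))" using coding_unfold[of w] by simp
  moreover have "shd w \<in> I" "coding (stl w) \<in> attractor"
    using streams_shd[OF w(1)] streams_stl[OF w(1)] by (auto simp: attractor_def)
  ultimately show "x \<in> (\<Union>i\<in>I. branch i ` attractor)" by blast
next
  fix x assume "x \<in> (\<Union>i\<in>I. branch i ` attractor)"
  then obtain i w where iw: "i \<in> I" "w \<in> streams I" "x = branch i (coding w)"
    by (auto simp: attractor_def)
  then have "i ## w \<in> streams I" by (simp add: streams_Stream)
  moreover from this have "x = coding (i ## w)" using iw coding_unfold[of "i ## w"] by simp
  ultimately show "x \<in> attractor" by (auto simp: attractor_def)
qed

lemma attractor_nonempty: "attractor \<noteq> {}"
  using I_nonempty by (auto simp: attractor_def streams_empty_iff)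

lemma bounded_attractor: "bounded attractor"
proof -
  obtain C \<rho> where *: "0 < \<rho>" "\<rho> < 1"
    "\<And>w n. w \<in> streams I \<Longrightarrow> norm (c (w !! n) * (\<Prod>j<n. r (w !! j))) \<le> C * \<rho> ^ n"
    by (rule coding_term_bound) (rule that)
  have "summable (\<lambda>n. C * \<rho> ^ n)"
    using * by (intro summable_mult summable_geometric) auto
  then have "norm (coding w) \<le> (\<Sum>n. C * \<rho> ^ n)" if "w \<in> streams I" for w
    unfolding coding_def using *(3)[OF that] by (intro norm_suminf_le)
  then show ?thesis by (auto simp: bounded_iff attractor_def)
qed

text \<open>The closure of the attractor is again bounded and covered by its own images, so all its
  points have addresses.\<close>

lemma compact_attractor: "compact attractor"
proof -
  let ?C = "closure attractor"
  have cont: "continuous_on A (branch i)" for A i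
    unfolding branch_def by (intro continuous_intros)
  have "compact ?C" using bounded_attractor by (simp add: compact_closure)
  then have cl: "closed (\<Union>i\<in>I. branch i ` ?C)"
    using finite_I by (intro closed_UN ballI compact_imp_closed compact_continuous_image cont)
  have "attractor \<subseteq> (\<Union>i\<in>I. branch i ` ?C)"
    using attractor_eq closure_subset[of attractor] by blast
  then have "?C \<subseteq> (\<Union>i\<in>I. branch i ` ?C)" using cl by (rule closure_minimal)
  then have "?C \<subseteq> attractor" using bounded_attractor by (intro subset_attractor) auto
  then have "?C = attractor" using closure_subset by blast
  then show ?thesis using \<open>compact ?C\<close> by simp
qed

lemma self_similar_fractal_attractor: "self_similar_fractal attractor"
proof -
  have "attractor = (\<Union>f\<in>branch ` I. f ` attractor)" using attractor_eq by simp
  then show ?thesis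
    unfolding self_similar_fractal_def
    using attractor_nonempty compact_attractor finite_I contracting_similarity_branch
    by (intro conjI exI[of _ "branch ` I"]) auto
qed

text \<open>Any bounded function on addresses that obeys the recursion of the coding map is the coding
  map.\<close>

lemma coding_eqI:
  assumes w: "w \<in> streams I" and bd: "\<And>v. v \<in> streams I \<Longrightarrow> \<bar>h v\<bar> \<le> M"
    and rec: "\<And>v. v \<in> streams I \<Longrightarrow> h v = branch (shd v) (h (stl v))"
  shows "h w = coding w"
proof -
  have s: "sdrop n w \<in> streams I" for n
    using w by (simp add: streams_iff_snth sdrop_snth)
  have "h (sdrop n w) = branch (w !! n) (h (sdrop (Suc n) w))" for n
    using rec[OF s[of n]] by (simp only: sdrop_simps)
  then have "h (sdrop 0 w) = coding w"
    by (rule coding_unique[OF w bd[OF s]])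
  then show ?thesis by simp
qed

lemma coding_nonneg:
  assumes "\<And>i. i \<in> I \<Longrightarrow> 0 \<le> c i" and w: "w \<in> streams I"
  shows "0 \<le> coding w"
  unfolding coding_def using assms ratio_prod_pos[OF w]
  by (intro suminf_nonneg[OF coding_summable[OF w]])
    (auto intro!: mult_nonneg_nonneg simp: snth_in less_imp_le)

lemma coding_le_1:
  assumes le: "\<And>i. i \<in> I \<Longrightarrow> c i + r i \<le> 1" and w: "w \<in> streams I"
  shows "coding w \<le> 1"
proof -
  let ?S = "\<lambda>n. \<Sum>k<n. c (w !! k) * (\<Prod>j<k. r (w !! j))"
  let ?P = "\<lambda>n. \<Prod>j<n. r (w !! j)"
  have "?S n + ?P n \<le> 1" for n
  proof (induction n)
    case (Suc n)
    have "?P n * (c (w !! n) + r (w !! n)) \<le> ?P n * 1"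
      using ratio_prod_pos[OF w, of n] le[OF snth_in[OF w]] by (intro mult_left_mono) auto
    with Suc show ?case by (simp add: algebra_simps)
  qed simp
  then have "?S n \<le> 1" for n using ratio_prod_pos[OF w, of n] by (smt (verit))
  then show ?thesis
    unfolding coding_def by (intro suminf_le_const[OF coding_summable[OF w]])
qed

end

section \<open>Hausdorff measure and dimension\<close>

lemma hausdorff_premeasure_le:
  assumes "E \<subseteq> (\<Union>n. U n)" "\<And>n. bounded (U n)" "\<And>n. diameter (U n) \<le> \<delta>"
  shows "hausdorff_premeasure \<delta> t E \<le> (\<Sum>n. diam_pow t (U n))"
  unfolding hausdorff_premeasure_def using assms by (intro Inf_lower) auto

lemma diam_pow_eq: "0 < t \<Longrightarrow> diam_pow t U = ennreal (diameter U powr t)"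
  by (auto simp: diam_pow_def)

lemma diam_pow_antimono:
  assumes "0 \<le> t" "t \<le> a" "0 < a" "bounded U" "diameter U \<le> 1"
  shows "ennreal (diameter U powr a) \<le> diam_pow t U"
proof (cases "t = 0")
  case True
  have "diameter U powr a \<le> 1 powr a"
    using assms diameter_ge_0[OF \<open>bounded U\<close>] by (intro powr_mono2) auto
  then show ?thesis using True \<open>0 < a\<close> by (auto simp: diam_pow_def)
next
  case False
  have "diameter U powr a \<le> diameter U powr t"
    using assms diameter_ge_0[OF \<open>bounded U\<close>] by (intro powr_mono') auto
  then show ?thesis using False assms by (auto simp: diam_pow_eq intro: ennreal_leI)
qed

lemma hausdorff_premeasure_compact_finite:
  fixes K :: "'a::metric_space set"
  assumes "compact K" "0 < t" "0 < \<delta>"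
  shows "hausdorff_premeasure \<delta> t K < \<infinity>"
proof -
  obtain X where X: "finite X" "K \<subseteq> (\<Union>x\<in>X. ball x (\<delta> / 2))"
    using seq_compact_imp_totally_bounded[of K] assms by (metis compact_eq_seq_compact_metric half_gt_zero)
  obtain xs where xs: "set xs = X" using X finite_list by blast
  define U where "U n = (if n < length xs then ball (xs ! n) (\<delta> / 2) else {})" for n
  have "diameter (U n) \<le> \<delta>" for n
  proof -
    have "dist y z \<le> \<delta>" if "dist x y < \<delta> / 2" "dist x z < \<delta> / 2" for x y z :: 'a
      using dist_triangle3[of y z x] that by simp
    then show ?thesis
      unfolding diameter_def U_def using \<open>0 < \<delta>\<close> by (auto intro!: cSUP_least)
  qed
  moreover have "bounded (U n)" for n by (simp add: U_def)
  moreover have "K \<subseteq> (\<Union>n. U n)"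
  proof
    fix y assume "y \<in> K"
    then obtain x where "x \<in> X" "y \<in> ball x (\<delta> / 2)" using X by blast
    then obtain n where "n < length xs" "y \<in> ball (xs ! n) (\<delta> / 2)"
      using xs by (metis in_set_conv_nth)
    then show "y \<in> (\<Union>n. U n)" by (auto simp: U_def)
  qed
  ultimately have "hausdorff_premeasure \<delta> t K \<le> (\<Sum>n. diam_pow t (U n))"
    by (intro hausdorff_premeasure_le)
  also have "\<dots> = (\<Sum>n<length xs. diam_pow t (U n))"
    using \<open>0 < t\<close> by (intro suminf_finite) (auto simp: U_def diam_pow_eq)
  also have "\<dots> < \<infinity>" using \<open>0 < t\<close> by (simp add: diam_pow_eq)
  finally show ?thesis .
qed

lemma hausdorff_dim_eqI:
  assumes "0 \<le> a" "\<And>t. a < t \<Longrightarrow> hausdorff_measure t E = 0"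
    and "\<And>t. 0 \<le> t \<Longrightarrow> t < a \<Longrightarrow> hausdorff_measure t E \<noteq> 0"
  shows "hausdorff_dim E = ennreal a"
  unfolding hausdorff_dim_def
proof (rule antisym)
  show "Inf {ennreal t |t. 0 \<le> t \<and> hausdorff_measure t E = 0} \<le> ennreal a"
  proof (rule ennreal_le_epsilon)
    fix e :: real assume "0 < e"
    then have "Inf {ennreal t |t. 0 \<le> t \<and> hausdorff_measure t E = 0} \<le> ennreal (a + e)"
      using assms(1) assms(2)[of "a + e"]
      by (intro Inf_lower CollectI exI[of _ "a + e"]) auto
    then show "Inf {ennreal t |t. 0 \<le> t \<and> hausdorff_measure t E = 0} \<le> ennreal a + ennreal e"
      using assms(1) \<open>0 < e\<close> by (simp add: ennreal_plus)
  qed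
  show "ennreal a \<le> Inf {ennreal t |t. 0 \<le> t \<and> hausdorff_measure t E = 0}"
    using assms(3) by (force intro!: Inf_greatest ennreal_leI simp: not_less[symmetric])
qed

context affine_ifs
begin

text \<open>The images under all branches of a cover of the attractor form a new cover whose total cost
  is \<open>\<Sum>i\<in>I. r i powr t\<close> times the old one. If this factor is less than one, the infimum of the
  costs, being finite, must vanish.\<close>

lemma hausdorff_premeasure_attractor_le:
  assumes "0 < t" and U: "attractor \<subseteq> (\<Union>n. U n)" "\<And>n. bounded (U n)" "\<And>n. diameter (U n) \<le> \<delta>"
  shows "hausdorff_premeasure \<delta> t attractor
    \<le> ennreal (\<Sum>i\<in>I. r i powr t) * (\<Sum>n. diam_pow t (U n))"
proof -
  define V where "V = (\<lambda>(i, n). if i \<in> I then branch i ` U n else {})"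
  have bd: "bounded (branch i ` U n)" for i n
  proof -
    obtain M where "\<And>x. x \<in> U n \<Longrightarrow> norm x \<le> M" using U(2)[of n] by (auto simp: bounded_iff)
    then have "norm (branch i x) \<le> \<bar>c i\<bar> + \<bar>r i\<bar> * M" if "x \<in> U n" for x
      using that mult_left_mono[of "\<bar>x\<bar>" M "\<bar>r i\<bar>"] abs_triangle_ineq[of "c i" "r i * x"]
      by (fastforce simp: branch_def abs_mult)
    then show ?thesis by (auto simp: bounded_iff)
  qed
  have diam: "diameter (branch i ` U n) \<le> r i * diameter (U n)" if "i \<in> I" for i n
  proof (rule diameter_le)
    show "branch i ` U n \<noteq> {} \<or> 0 \<le> r i * diameter (U n)"
      using ratio_pos[OF that] diameter_ge_0[OF U(2)[of n]] by simp
    fix x y assume "x \<in> branch i ` U n" "y \<in> branch i ` U n"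
    then obtain x' y' where *: "x' \<in> U n" "y' \<in> U n" "x = branch i x'" "y = branch i y'" by blast
    then have "norm (x - y) = r i * dist x' y'" using dist_branch[OF that] by (simp add: dist_norm)
    also have "\<dots> \<le> r i * diameter (U n)"
      using diameter_bounded_bound[OF U(2)[of n] *(1,2)] ratio_pos[OF that]
      by (intro mult_left_mono) auto
    finally show "norm (x - y) \<le> r i * diameter (U n)" .
  qed
  have "0 \<le> \<delta>" using U(3)[of 0] diameter_ge_0[OF U(2)[of 0]] by simp
  have V1: "attractor \<subseteq> (\<Union>m. V (prod_decode m))"
  proof
    fix x assume "x \<in> attractor"
    then obtain i y where iy: "i \<in> I" "y \<in> attractor" "x = branch i y" using attractor_eq by blast
    then obtain n where "y \<in> U n" using U(1) by blast
    then have "x \<in> V (prod_decode (prod_encode (i, n)))" using iy by (simp add: V_def)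
    then show "x \<in> (\<Union>m. V (prod_decode m))" by blast
  qed
  have V2: "bounded (V x)" for x using bd by (cases x) (simp add: V_def)
  have V3: "diameter (V x) \<le> \<delta>" for x
  proof (cases x)
    case (Pair i n)
    show ?thesis
    proof (cases "i \<in> I")
      case True
      have "r i * diameter (U n) \<le> 1 * diameter (U n)"
        using ratio_less_1[OF True] diameter_ge_0[OF U(2)[of n]] by (intro mult_right_mono) auto
      then show ?thesis using diam[OF True, of n] U(3)[of n] True Pair by (simp add: V_def)
    qed (use Pair \<open>0 \<le> \<delta>\<close> in \<open>simp add: V_def\<close>)
  qed
  let ?S = "\<Sum>n. diam_pow t (U n)"
  have le: "(\<Sum>n. diam_pow t (V (i, n))) \<le> ennreal (r i powr t) * ?S" if "i \<in> I" for i
  proof -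
    have "diam_pow t (V (i, n)) \<le> ennreal (r i powr t) * diam_pow t (U n)" for n
    proof -
      have "diameter (branch i ` U n) powr t \<le> (r i * diameter (U n)) powr t"
        using diam[OF that] diameter_ge_0[OF bd] \<open>0 < t\<close> by (intro powr_mono2) auto
      also have "\<dots> = r i powr t * diameter (U n) powr t"
        by (rule powr_mult)
      finally show ?thesis
        using that \<open>0 < t\<close> by (simp add: V_def diam_pow_eq ennreal_leI flip: ennreal_mult')
    qed
    then have "(\<Sum>n. diam_pow t (V (i, n))) \<le> (\<Sum>n. ennreal (r i powr t) * diam_pow t (U n))"
      by (intro suminf_le) auto
    then show ?thesis by simp
  qed
  have "hausdorff_premeasure \<delta> t attractor \<le> (\<Sum>m. diam_pow t (V (prod_decode m)))"
    using V1 V2 V3 by (rule hausdorff_premeasure_le)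
  also have "\<dots> = (\<Sum>i. \<Sum>n. diam_pow t (V (i, n)))"
    by (rule suminf_ennreal_2dimen) simp
  also have "\<dots> = (\<Sum>i\<in>I. \<Sum>n. diam_pow t (V (i, n)))"
    using finite_I \<open>0 < t\<close> by (intro suminf_finite) (auto simp: V_def diam_pow_eq)
  also have "\<dots> \<le> (\<Sum>i\<in>I. ennreal (r i powr t) * ?S)"
    using le by (rule sum_mono)
  also have "\<dots> = ennreal (\<Sum>i\<in>I. r i powr t) * ?S"
    by (simp add: sum_distrib_right[symmetric])
  finally show ?thesis .
qed

lemma hausdorff_measure_attractor_eq_0:
  assumes "0 < t" "(\<Sum>i\<in>I. r i powr t) < 1"
  shows "hausdorff_measure t attractor = 0"
proof -
  let ?\<theta> = "\<Sum>i\<in>I. r i powr t"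
  have pos: "0 < ?\<theta>"
    using finite_I I_nonempty ratio_pos by (intro sum_pos) force+
  have "hausdorff_premeasure \<delta> t attractor = 0" if "0 < \<delta>" for \<delta>
  proof -
    let ?h = "hausdorff_premeasure \<delta> t attractor"
    have fin: "?h < \<infinity>"
      using compact_attractor \<open>0 < t\<close> that by (rule hausdorff_premeasure_compact_finite)
    have "?h / ennreal ?\<theta> \<le> ?h"
    proof (subst (2) hausdorff_premeasure_def, rule Inf_greatest)
      fix y assume "y \<in> {(\<Sum>n. diam_pow t (U n)) |U. attractor \<subseteq> (\<Union>n. U n) \<and>
        (\<forall>n. bounded (U n) \<and> diameter (U n) \<le> \<delta>)}"
      then obtain U where "y = (\<Sum>n. diam_pow t (U n))" "attractor \<subseteq> (\<Union>n. U n)"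
        "\<And>n. bounded (U n)" "\<And>n. diameter (U n) \<le> \<delta>" by blast
      then have "?h \<le> ennreal ?\<theta> * y"
        using hausdorff_premeasure_attractor_le[OF \<open>0 < t\<close>] by blast
      then show "?h / ennreal ?\<theta> \<le> y"
        using pos by (intro divide_le_posI_ennreal) (auto simp: mult.commute)
    qed
    moreover obtain x where x: "0 \<le> x" "?h = ennreal x" using fin by (cases ?h) auto
    ultimately have "x / ?\<theta> \<le> x" using pos by (simp add: divide_ennreal)
    then have "x \<le> x * ?\<theta>" using pos by (simp add: pos_divide_le_eq)
    then have "x * (1 - ?\<theta>) \<le> 0" by (simp add: algebra_simps)
    then have "x = 0" using x assms(2) by (simp add: mult_le_0_iff)
    then show ?thesis using x by simp
  qed
  then show ?thesis unfolding hausdorff_measure_def by (auto intro!: SUP_eq_const)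
qed

end

section \<open>Lower bound under strong separation\<close>

text \<open>Consecutive intervals of lengths \<open>q i\<close>, laid out from 0 in the order of the indices, cover
  the interval from 0 to the sum of all lengths.\<close>

lemma consecutive_intervals_cover:
  fixes q :: "nat \<Rightarrow> real"
  assumes "finite I" "I \<noteq> {}" "0 \<le> y" "y \<le> (\<Sum>i\<in>I. q i)"
  shows "\<exists>i\<in>I. (\<Sum>j | j \<in> I \<and> j < i. q j) \<le> y \<and> y \<le> (\<Sum>j | j \<in> I \<and> j < i. q j) + q i"
  using assms
proof (induction I rule: finite_linorder_max_induct)
  case (insert b A)
  have b: "{j. j \<in> insert b A \<and> j < b} = A" using insert.hyps by auto
  have A: "{j. j \<in> insert b A \<and> j < i} = {j. j \<in> A \<and> j < i}" if "i \<in> A" for i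
    using insert.hyps that by auto
  have "b \<notin> A" using insert.hyps by blast
  show ?case
  proof (cases "A \<noteq> {} \<and> y \<le> sum q A")
    case True
    then obtain i where "i \<in> A" "(\<Sum>j | j \<in> A \<and> j < i. q j) \<le> y"
      "y \<le> (\<Sum>j | j \<in> A \<and> j < i. q j) + q i"
      using insert.IH insert.prems by blast
    then show ?thesis using A by (intro bexI[of _ i]) auto
  next
    case False
    then have "sum q A \<le> y" using insert.prems by auto
    moreover have "y \<le> sum q A + q b"
      using insert.prems \<open>b \<notin> A\<close> insert.hyps by simp
    ultimately have "(\<Sum>j | j \<in> insert b A \<and> j < b. q j) \<le> y \<and>
        y \<le> (\<Sum>j | j \<in> insert b A \<and> j < b. q j) + q b"
      unfolding b by (rule conjI)
    then show ?thesis by blast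
  qed
qed simp

text \<open>Strong separation condition: the first-level pieces of the attractor are disjoint.\<close>

locale separated_ifs = affine_ifs +
  assumes disjoint: "i \<in> I \<Longrightarrow> j \<in> I \<Longrightarrow> i \<noteq> j \<Longrightarrow>
    branch i ` attractor \<inter> branch j ` attractor = {}"
begin

lemma separation_gap:
  obtains \<delta> where "0 < \<delta>" "\<And>i j x y. i \<in> I \<Longrightarrow> j \<in> I \<Longrightarrow> i \<noteq> j \<Longrightarrow> x \<in> attractor \<Longrightarrow>
    y \<in> attractor \<Longrightarrow> \<delta> \<le> dist (branch i x) (branch j y)"
proof -
  let ?P = "{(i, j). i \<in> I \<and> j \<in> I \<and> i \<noteq> j}"
  have comp: "compact (branch i ` attractor)" for i
    unfolding branch_def by (intro compact_continuous_image continuous_intros compact_attractor)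
  have "\<exists>d>0. \<forall>x\<in>attractor. \<forall>y\<in>attractor. d \<le> dist (branch i x) (branch j y)"
    if "i \<in> I" "j \<in> I" "i \<noteq> j" for i j
    using separate_compact_closed[OF comp compact_imp_closed[OF comp] disjoint[OF that]] by auto
  then have "\<forall>ij\<in>?P. \<exists>d>0. \<forall>x\<in>attractor. \<forall>y\<in>attractor.
      d \<le> dist (branch (fst ij) x) (branch (snd ij) y)" by auto
  from bchoice[OF this] obtain d where "\<forall>ij\<in>?P. 0 < d ij \<and> (\<forall>x\<in>attractor. \<forall>y\<in>attractor.
      d ij \<le> dist (branch (fst ij) x) (branch (snd ij) y))" ..
  then have d: "\<And>ij. ij \<in> ?P \<Longrightarrow> 0 < d ij" "\<And>ij x y. ij \<in> ?P \<Longrightarrow> x \<in> attractor \<Longrightarrow>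
      y \<in> attractor \<Longrightarrow> d ij \<le> dist (branch (fst ij) x) (branch (snd ij) y)"
    by blast+
  have "finite ?P" using finite_I by (intro finite_subset[of ?P "I \<times> I"]) auto
  \<comment> \<open>The element 1 covers the case of a single branch, in which there are no pairs.\<close>
  define \<delta> where "\<delta> = Min (insert 1 (d ` ?P))"
  have "0 < \<delta>" unfolding \<delta>_def using \<open>finite ?P\<close> d(1) by (subst Min_gr_iff) auto
  moreover have gap_le: "\<delta> \<le> d ij" if "ij \<in> ?P" for ij
    unfolding \<delta>_def using \<open>finite ?P\<close> that by (intro Min_le) auto
  moreover have "\<delta> \<le> dist (branch i x) (branch j y)"
    if "i \<in> I" "j \<in> I" "i \<noteq> j" "x \<in> attractor" "y \<in> attractor" for i j x y
    using d(2)[of "(i, j)" x y] gap_le[of "(i, j)"] that by simp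
  ultimately show thesis by (intro that) auto
qed

text \<open>Two addresses that first differ in position \<open>n\<close> code points that lie in a common
  cylinder of level \<open>n\<close>, a copy of the attractor scaled by the product of the first \<open>n\<close> ratios, and
  in different pieces of it, which are at least \<open>\<delta>\<close> times this product apart.\<close>

lemma coding_dist_lower_bound:
  assumes gap: "\<And>i j x y. i \<in> I \<Longrightarrow> j \<in> I \<Longrightarrow> i \<noteq> j \<Longrightarrow> x \<in> attractor \<Longrightarrow>
      y \<in> attractor \<Longrightarrow> \<delta> \<le> dist (branch i x) (branch j y)"
    and "v \<in> streams I" "w \<in> streams I" "stake n v = stake n w" "v !! n \<noteq> w !! n"
  shows "\<delta> * (\<Prod>j<n. r (v !! j)) \<le> dist (coding v) (coding w)"
  using assms(2-)
proof (induction n arbitrary: v w)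
  case 0
  then have "coding (stl v) \<in> attractor" "coding (stl w) \<in> attractor"
    by (auto simp: attractor_def intro!: imageI streams_stl)
  with 0 show ?case
    using gap[of "shd v" "shd w"] streams_shd[of v I] streams_shd[of w I]
      coding_unfold[of v] coding_unfold[of w] by simp
next
  case (Suc n)
  have eq: "shd v = shd w" using Suc.prems by simp
  have v: "shd v \<in> I" using Suc.prems(1) by (rule streams_shd)
  have "\<delta> * (\<Prod>j<n. r (stl v !! j)) \<le> dist (coding (stl v)) (coding (stl w))"
    using Suc.prems by (intro Suc.IH) (auto intro: streams_stl)
  then have "r (shd v) * (\<delta> * (\<Prod>j<n. r (stl v !! j)))
      \<le> r (shd v) * dist (coding (stl v)) (coding (stl w))"
    using ratio_pos[OF v] by (intro mult_left_mono) auto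
  also have "\<dots> = dist (coding v) (coding w)"
    using dist_branch[OF v] coding_unfold[OF Suc.prems(1)] coding_unfold[OF Suc.prems(2)] eq by simp
  finally show ?case
    by (simp add: prod.lessThan_Suc_shift ac_simps del: prod.lessThan_Suc)
qed

end

lemma (in affine_ifs) coding_dist_upper_bound:
  assumes "\<And>w. w \<in> streams I \<Longrightarrow> coding w \<in> {0..1}"
    and "v \<in> streams I" "w \<in> streams I" "stake n v = stake n w"
  shows "dist (coding v) (coding w) \<le> (\<Prod>j<n. r (v !! j))"
  using assms(2-)
proof (induction n arbitrary: v w)
  case 0
  then show ?case using assms(1)[of v] assms(1)[of w] by (auto simp: dist_real_def abs_le_iff)
next
  case (Suc n)
  have eq: "shd v = shd w" using Suc.prems by simp
  have v: "shd v \<in> I" using Suc.prems(1) by (rule streams_shd)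
  have "dist (coding (stl v)) (coding (stl w)) \<le> (\<Prod>j<n. r (stl v !! j))"
    using Suc.prems by (intro Suc.IH) (auto intro: streams_stl)
  then have "r (shd v) * dist (coding (stl v)) (coding (stl w)) \<le> r (shd v) * (\<Prod>j<n. r (stl v !! j))"
    using ratio_pos[OF v] by (intro mult_left_mono) auto
  moreover have "r (shd v) * dist (coding (stl v)) (coding (stl w)) = dist (coding v) (coding w)"
    using dist_branch[OF v] coding_unfold[OF Suc.prems(1)] coding_unfold[OF Suc.prems(2)] eq by simp
  ultimately show ?case
    by (simp add: prod.lessThan_Suc_shift ac_simps del: prod.lessThan_Suc)
qed

lemma first_difference:
  assumes "v \<noteq> w"
  obtains n where "stake n v = stake n w" "v !! n \<noteq> w !! n"
proof -
  have ex: "\<exists>n. v !! n \<noteq> w !! n" using assms by (metis smap_alt stream.map_ident)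
  define n where "n = (LEAST n. v !! n \<noteq> w !! n)"
  have "v !! n \<noteq> w !! n" unfolding n_def using ex by (rule LeastI_ex)
  moreover have "v !! m = w !! m" if "m < n" for m
    using not_less_Least[OF that[unfolded n_def]] by simp
  then have "stake n v = stake n w" by (intro nth_equalityI) auto
  ultimately show thesis by (rule that[rotated])
qed

context separated_ifs
begin

text \<open>Reading the address of a point of the attractor in the system with ratios \<open>r i powr a\<close> whose
  branches tile the unit interval maps the attractor onto that interval. The map is Hoelder
  continuous of exponent \<open>a\<close>: the product of the new ratios along an address is the \<open>a\<close>-th power
  of the product of the old ones. It is stated here as a map \<open>G\<close> on addresses.\<close>

lemma hoelder_surjection:
  assumes "0 < a" and sum1: "(\<Sum>i\<in>I. r i powr a) = 1"
  obtains G L where "0 < L" "{0..1} \<subseteq> G ` streams I"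
    "\<And>v w. v \<in> streams I \<Longrightarrow> w \<in> streams I \<Longrightarrow>
      dist (G v :: real) (G w) \<le> L * dist (coding v) (coding w) powr a"
proof -
  define q where "q i = r i powr a" for i
  define c' where "c' i = (\<Sum>j | j \<in> I \<and> j < i. q j)" for i
  have q: "0 < q i" "q i < 1" if "i \<in> I" for i
    using ratio_pos[OF that] ratio_less_1[OF that] powr_less_mono2[of a "r i" 1] \<open>0 < a\<close>
    by (auto simp: q_def)
  interpret G: affine_ifs I c' q
    using finite_I I_nonempty q by unfold_locales auto
  have "{0..1} \<subseteq> G.attractor"
  proof (rule G.subset_attractor)
    show "{0..1} \<subseteq> (\<Union>i\<in>I. G.branch i ` {0..1})"
    proof
      fix y :: real assume y: "y \<in> {0..1}"
      then obtain i where i: "i \<in> I" "c' i \<le> y" "y \<le> c' i + q i"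
        using consecutive_intervals_cover[OF finite_I I_nonempty, of y q] sum1
        by (auto simp: q_def c'_def)
      then have "y = G.branch i ((y - c' i) / q i)" "(y - c' i) / q i \<in> {0..1}"
        using q[OF i(1)] by (auto simp: G.branch_def field_simps)
      then show "y \<in> (\<Union>i\<in>I. G.branch i ` {0..1})" using i(1) by blast
    qed
  qed simp
  have c'q: "c' i + q i \<le> 1" if "i \<in> I" for i
  proof -
    have "c' i + q i = sum q (insert i {j \<in> I. j < i})"
      using finite_I by (simp add: c'_def)
    also have "\<dots> \<le> sum q I"
      using finite_I that q by (intro sum_mono2) (auto simp: less_imp_le)
    finally show ?thesis using sum1 by (simp add: q_def)
  qed
  have "0 \<le> c' i" for i
    unfolding c'_def using q by (intro sum_nonneg) (auto simp: less_imp_le)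
  then have unit: "G.coding w \<in> {0..1}" if "w \<in> streams I" for w
    using G.coding_nonneg G.coding_le_1 c'q that by simp
  obtain \<delta> where \<delta>: "0 < \<delta>" "\<And>i j x y. i \<in> I \<Longrightarrow> j \<in> I \<Longrightarrow> i \<noteq> j \<Longrightarrow> x \<in> attractor \<Longrightarrow>
    y \<in> attractor \<Longrightarrow> \<delta> \<le> dist (branch i x) (branch j y)" by (rule separation_gap) (rule that)
  have "dist (G.coding v) (G.coding w) \<le> (1 / \<delta>) powr a * dist (coding v) (coding w) powr a"
    if vw: "v \<in> streams I" "w \<in> streams I" for v w
  proof (cases "v = w")
    case False
    then obtain n where n: "stake n v = stake n w" "v !! n \<noteq> w !! n" by (rule first_difference)
    let ?P = "\<Prod>j<n. r (v !! j)"
    have "dist (G.coding v) (G.coding w) \<le> (\<Prod>j<n. q (v !! j))"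
      using unit vw n(1) by (rule G.coding_dist_upper_bound)
    also have "\<dots> = ?P powr a" by (simp add: q_def prod_powr_distrib)
    also have "\<dots> \<le> (1 / \<delta> * dist (coding v) (coding w)) powr a"
    proof (rule powr_mono2)
      have "\<delta> * ?P \<le> dist (coding v) (coding w)"
        using \<delta>(2) vw n by (rule coding_dist_lower_bound)
      then show "?P \<le> 1 / \<delta> * dist (coding v) (coding w)" using \<delta>(1) by (simp add: field_simps)
    qed (use \<open>0 < a\<close> ratio_prod_pos[OF vw(1), of n] in auto)
    finally show ?thesis by (simp only: powr_mult)
  qed simp
  moreover have "0 < (1 / \<delta>) powr a" using \<delta>(1) by simp
  ultimately show thesis
    using \<open>{0..1} \<subseteq> G.attractor\<close> that[of "(1 / \<delta>) powr a" G.coding] by (simp add: G.attractor_def)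
qed

text \<open>A Hoelder surjection carries a cover of the attractor to a cover of the unit interval by sets
  of diameter at most \<open>L * diameter (U n) powr a\<close>. Each of them lies in an interval of twice that
  length, and the lengths of these intervals sum to at least one.\<close>

lemma cover_cost_lower_bound:
  assumes "0 < a" "(\<Sum>i\<in>I. r i powr a) = 1"
  shows "\<exists>L>0. \<forall>U. attractor \<subseteq> (\<Union>n. U n) \<longrightarrow> (\<forall>n. bounded (U n)) \<longrightarrow>
    1 \<le> ennreal L * (\<Sum>n. ennreal (diameter (U n) powr a))"
proof -
  obtain G L where G: "0 < L" "{0..1} \<subseteq> G ` streams I"
    "\<And>v w. v \<in> streams I \<Longrightarrow> w \<in> streams I \<Longrightarrow>
      dist (G v :: real) (G w) \<le> L * dist (coding v) (coding w) powr a"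
    using assms by (rule hoelder_surjection) (rule that)
  have "1 \<le> ennreal (2 * L) * (\<Sum>n. ennreal (diameter (U n) powr a))"
    if U: "attractor \<subseteq> (\<Union>n. U n)" "\<And>n. bounded (U n)" for U :: "nat \<Rightarrow> real set"
  proof -
    define d where "d n = L * diameter (U n) powr a" for n
    define W where "W n = {w \<in> streams I. coding w \<in> U n}" for n
    have d0: "0 \<le> d n" for n using \<open>0 < L\<close> by (simp add: d_def)
    have "\<exists>J. J \<in> sets lborel \<and> G ` W n \<subseteq> J \<and> emeasure lborel J \<le> ennreal (2 * d n)" for n
    proof (cases "W n = {}")
      case False
      then obtain v where v: "v \<in> W n" by blast
      have "dist (G v) (G w) \<le> d n" if "w \<in> W n" for w
      proof -
        have "dist (G v) (G w) \<le> L * dist (coding v) (coding w) powr a"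
          using G(3) v that by (simp add: W_def)
        also have "\<dots> \<le> L * diameter (U n) powr a"
          using v that \<open>0 < L\<close> \<open>0 < a\<close> diameter_bounded_bound[OF U(2)[of n]]
          by (intro mult_left_mono powr_mono2) (auto simp: W_def)
        finally show ?thesis by (simp add: d_def)
      qed
      then have "G ` W n \<subseteq> {G v - d n..G v + d n}"
        by (fastforce simp: dist_real_def abs_le_iff)
      moreover have "emeasure lborel {G v - d n..G v + d n} = ennreal (2 * d n)"
        using d0[of n] by (simp add: algebra_simps)
      ultimately show ?thesis by (intro exI[of _ "{G v - d n..G v + d n}"]) simp
    qed (intro exI[of _ "{}"], simp)
    then obtain J where J: "\<And>n. J n \<in> sets lborel" "\<And>n. G ` W n \<subseteq> J n"
      "\<And>n. emeasure lborel (J n) \<le> ennreal (2 * d n)" by metis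
    have "{0..1} \<subseteq> (\<Union>n. J n)"
    proof
      fix y :: real assume "y \<in> {0..1}"
      then obtain w where w: "w \<in> streams I" "y = G w" using G(2) by blast
      then obtain n where "coding w \<in> U n" using U(1) by (auto simp: attractor_def)
      then show "y \<in> (\<Union>n. J n)" using w J(2)[of n] by (auto simp: W_def)
    qed
    then have "emeasure lborel {0..1::real} \<le> emeasure lborel (\<Union>n. J n)"
      using J(1) by (intro emeasure_mono) auto
    also have "\<dots> \<le> (\<Sum>n. emeasure lborel (J n))"
      using J(1) by (intro emeasure_subadditive_countably) auto
    also have "\<dots> \<le> (\<Sum>n. ennreal (2 * d n))"
      using J(3) by (intro suminf_le) auto
    also have "\<dots> = (\<Sum>n. ennreal (2 * L) * ennreal (diameter (U n) powr a))"
      using \<open>0 < L\<close> by (simp add: d_def ennreal_mult mult.assoc)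
    finally show ?thesis by simp
  qed
  then show ?thesis using \<open>0 < L\<close> by (intro exI[of _ "2 * L"]) auto
qed

lemma hausdorff_measure_attractor_neq_0:
  assumes "0 \<le> t" "t < a" "(\<Sum>i\<in>I. r i powr a) = 1"
  shows "hausdorff_measure t attractor \<noteq> 0"
proof -
  have "0 < a" using assms by simp
  obtain L where L: "0 < L" "\<And>U. attractor \<subseteq> (\<Union>n. U n) \<Longrightarrow> (\<And>n. bounded (U n)) \<Longrightarrow>
    1 \<le> ennreal L * (\<Sum>n. ennreal (diameter (U n) powr a))"
    using cover_cost_lower_bound[OF \<open>0 < a\<close> assms(3)] by auto
  \<comment> \<open>For covers by sets of diameter at most 1 the cost decreases as the exponent grows.\<close>
  have "1 / ennreal L \<le> hausdorff_premeasure 1 t attractor"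
    unfolding hausdorff_premeasure_def
  proof (rule Inf_greatest)
    fix y assume "y \<in> {(\<Sum>n. diam_pow t (U n)) |U. attractor \<subseteq> (\<Union>n. U n) \<and>
        (\<forall>n. bounded (U n) \<and> diameter (U n) \<le> 1)}"
    then obtain U where U: "y = (\<Sum>n. diam_pow t (U n))" "attractor \<subseteq> (\<Union>n. U n)"
        "\<And>n. bounded (U n)" "\<And>n. diameter (U n) \<le> 1" by blast
    have "(\<Sum>n. ennreal (diameter (U n) powr a)) \<le> y"
      unfolding U(1) using U(3,4) assms \<open>0 < a\<close> by (intro suminf_le diam_pow_antimono) auto
    then have "1 \<le> ennreal L * y"
      using L(2)[OF U(2,3)] by (meson order_trans mult_left_mono zero_le)
    then show "1 / ennreal L \<le> y"
      using L(1) by (intro divide_le_posI_ennreal) (auto simp: mult.commute)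
  qed
  also have "\<dots> \<le> hausdorff_measure t attractor"
    unfolding hausdorff_measure_def by (intro SUP_upper) simp
  finally show ?thesis using L(1) by (auto simp: ennreal_divide_eq_0_iff)
qed

text \<open>If \<open>a = 0\<close>, which happens for a single branch, only the upper bound is needed.\<close>

lemma hausdorff_dim_attractor:
  assumes "0 \<le> a" "(\<Sum>i\<in>I. r i powr a) = 1"
  shows "hausdorff_dim attractor = ennreal a"
proof (rule hausdorff_dim_eqI[OF assms(1)])
  fix t assume "a < t"
  then have "(\<Sum>i\<in>I. r i powr t) < (\<Sum>i\<in>I. r i powr a)"
    using finite_I I_nonempty ratio_pos ratio_less_1 by (intro sum_strict_mono powr_less_mono') auto
  then show "hausdorff_measure t attractor = 0"
    using assms \<open>a < t\<close> by (intro hausdorff_measure_attractor_eq_0) auto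
qed (use assms(2) hausdorff_measure_attractor_neq_0 in auto)

end

text \<open>The sum of the powers is at least one at exponent 0 and tends to zero.\<close>

lemma (in affine_ifs) similarity_exponent_exists:
  obtains a where "0 \<le> a" "(\<Sum>i\<in>I. r i powr a) = 1"
proof -
  let ?f = "\<lambda>t. \<Sum>i\<in>I. r i powr t"
  have "(\<lambda>n. \<Sum>i\<in>I. r i ^ n) \<longlonglongrightarrow> (\<Sum>i\<in>I. 0)"
    using ratio_pos ratio_less_1
    by (intro tendsto_sum LIMSEQ_power_zero) (simp add: abs_of_pos)
  then have "\<forall>\<^sub>F n in sequentially. (\<Sum>i\<in>I. r i ^ n) < 1"
    by (intro order_tendstoD(2)[where y = 0]) auto
  then obtain n where "(\<Sum>i\<in>I. r i ^ n) < 1" by (auto simp: eventually_sequentially)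
  then have "?f (real n) \<le> 1" using ratio_pos by (simp add: powr_realpow)
  moreover have "1 \<le> ?f 0"
  proof -
    have "?f 0 = real (card I)" using ratio_pos by (simp add: less_imp_neq[symmetric])
    then show ?thesis using finite_I I_nonempty by (simp add: Suc_le_eq card_gt_0_iff)
  qed
  moreover have "continuous_on {0..real n} ?f"
    using ratio_pos by (intro continuous_intros) force
  ultimately obtain a where "0 \<le> a" "?f a = 1" using IVT2'[of ?f "real n" 1 0] by auto
  then show thesis by (rule that)
qed

section \<open>Blocks of digits\<close>

text \<open>The digits are the numbers below \<open>s\<close>; the values of \<open>p\<close> elsewhere play no role.\<close>

locale digit_expansion =
  fixes s u :: nat and p :: "nat \<Rightarrow> real"
  assumes s_gt_2: "2 < s" and p_pos: "i < s \<Longrightarrow> 0 < p i"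
    and p_sum: "(\<Sum>i<s. p i) = 1" and u_less: "u < s"
begin

lemma p_less_1:
  assumes "i < s"
  shows "p i < 1"
proof -
  \<comment> \<open>There is a digit other than \<open>i\<close>, and its weight is positive.\<close>
  have "(if i = 0 then 1 else 0) \<in> {..<s} - {i}" using s_gt_2 by auto
  then have "0 < sum p ({..<s} - {i})" using p_pos by (intro sum_pos) auto
  then show ?thesis using p_sum assms by (simp add: sum_diff1)
qed

text \<open>The branch of index \<open>d\<close> of the first system prepends the digit \<open>d\<close>; its coding map is the
  P-representation.\<close>

sublocale digits: affine_ifs "{..<s}" "beta p" p
  using s_gt_2 p_pos p_less_1 by unfold_locales auto

lemma P_rep_eq_coding: "P_rep p w = digits.coding w"
  by (simp add: P_rep_def digits.coding_def)

lemma beta_Suc: "beta p (Suc d) = beta p d + p d"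
  by (simp add: beta_def)

lemma beta_mono: "d \<le> e \<Longrightarrow> e \<le> s \<Longrightarrow> beta p d \<le> beta p e"
  unfolding beta_def using p_pos by (intro sum_mono2) (auto intro: less_imp_le)

lemma beta_nonneg: "d < s \<Longrightarrow> 0 \<le> beta p d"
  using beta_mono[of 0 d] by (simp add: beta_def)

lemma digit_branch_bounds:
  assumes "d < s" "0 \<le> x" "x \<le> 1"
  shows "beta p d \<le> digits.branch d x" "digits.branch d x \<le> beta p (Suc d)"
    "0 \<le> digits.branch d x" "digits.branch d x \<le> 1" "0 < x \<Longrightarrow> beta p d < digits.branch d x"
proof -
  have *: "0 \<le> p d * x" "p d * x \<le> p d" using assms p_pos[of d] by (auto simp: mult_left_le)
  have "beta p (Suc d) \<le> 1" using beta_mono[of "Suc d" s] assms p_sum by (simp add: beta_def)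
  then show "beta p d \<le> digits.branch d x" "digits.branch d x \<le> beta p (Suc d)"
    "0 \<le> digits.branch d x" "digits.branch d x \<le> 1"
    using * beta_nonneg[OF assms(1)] by (auto simp: digits.branch_def beta_Suc)
  show "beta p d < digits.branch d x" if "0 < x"
    using that p_pos assms by (simp add: digits.branch_def)
qed

lemma digit_branch_neq:
  assumes "d < s" "e < s" "d \<noteq> e" "0 < x" "x \<le> 1" "0 < y" "y \<le> 1"
  shows "digits.branch d x \<noteq> digits.branch e y"
proof -
  have *: "digits.branch d x < digits.branch e y"
    if "d < e" "e < s" "0 < x" "x \<le> 1" "0 < y" "y \<le> 1" for d e x y
    using digit_branch_bounds(2)[of d x] digit_branch_bounds(5)[of e y] beta_mono[of "Suc d" e] that
    by simp
  show ?thesis using *[of d e x y] *[of e d y x] assms by (cases d e rule: linorder_cases) auto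
qed

lemma u_branches_bounds:
  assumes "0 \<le> x" "x \<le> 1"
  shows "0 \<le> (digits.branch u ^^ m) x \<and> (digits.branch u ^^ m) x \<le> 1 \<and>
    (0 < x \<longrightarrow> 0 < (digits.branch u ^^ m) x)"
proof (induction m)
  case (Suc m)
  then show ?case
    using digit_branch_bounds[OF u_less, of "(digits.branch u ^^ m) x"] beta_nonneg[OF u_less] by auto
qed (use assms in simp)

lemma u_branches_affine:
  "(digits.branch u ^^ m) x = (digits.branch u ^^ m) 0 + p u ^ m * x"
  by (induction m) (simp_all add: digits.branch_def algebra_simps)

text \<open>The possible last digits of a block.\<close>

definition block_digits :: "nat set" where
  "block_digits = {1..<s} - {u}"

lemma block_digits_iff [simp]: "k \<in> block_digits \<longleftrightarrow> 0 < k \<and> k < s \<and> k \<noteq> u"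
  by (auto simp: block_digits_def)

text \<open>The value at 0 and the slope of the map that prepends the block of \<open>k - 1\<close> digits \<open>u\<close> and
  a digit \<open>k\<close>.\<close>

definition block_offset :: "nat \<Rightarrow> real" where
  "block_offset k = (digits.branch u ^^ (k - 1)) (digits.branch k 0)"

definition block_ratio :: "nat \<Rightarrow> real" where
  "block_ratio k = p k * p u ^ (k - 1)"

sublocale blocks: affine_ifs block_digits block_offset block_ratio
proof
  show "block_digits \<noteq> {}"
  proof -
    have "(if u = 1 then 2 else 1) \<in> block_digits" using s_gt_2 by auto
    then show ?thesis by blast
  qed
  fix k assume k: "k \<in> block_digits"
  then show "0 < block_ratio k" using p_pos u_less by (simp add: block_ratio_def)
  have "p k * p u ^ (k - 1) \<le> p k * 1"
    using k p_pos p_less_1 u_less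
    by (intro mult_left_mono power_le_one) (auto intro: less_imp_le)
  then show "block_ratio k < 1" using p_less_1[of k] k by (simp add: block_ratio_def)
qed (simp add: block_digits_def)

lemma block_branch: "blocks.branch k x = (digits.branch u ^^ (k - 1)) (digits.branch k x)"
proof -
  have "(digits.branch u ^^ (k - 1)) (digits.branch k y)
      = (digits.branch u ^^ (k - 1)) 0 + p u ^ (k - 1) * (beta p k + p k * y)" for y
    by (subst u_branches_affine) (simp add: digits.branch_def)
  then show ?thesis
    by (simp add: blocks.branch_def block_offset_def block_ratio_def algebra_simps)
qed

lemma block_branch_bounds:
  assumes "k \<in> block_digits" "0 \<le> x" "x \<le> 1"
  shows "0 < blocks.branch k x" "blocks.branch k x \<le> 1"
proof -
  have "beta p 1 \<le> beta p k" using assms by (intro beta_mono) auto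
  moreover have "0 < beta p 1" using p_pos[of 0] s_gt_2 by (simp add: beta_def)
  ultimately have "0 < digits.branch k x" "digits.branch k x \<le> 1"
    using digit_branch_bounds[of k x] assms by auto
  then show "0 < blocks.branch k x" "blocks.branch k x \<le> 1"
    using u_branches_bounds[of "digits.branch k x" "k - 1"] by (auto simp: block_branch)
qed

text \<open>Every block contains a nonzero digit, so the attractor of the block system avoids the
  point 0. This matters because prepending different digits maps \<open>{0<..1}\<close>, but not
  \<open>{0..1}\<close>, to disjoint intervals.\<close>

lemma block_attractor_bounds:
  assumes "x \<in> blocks.attractor"
  shows "0 < x" "x \<le> 1"
proof -
  have "0 \<le> block_offset k" "block_offset k + block_ratio k \<le> 1" if "k \<in> block_digits" for k
    using block_branch_bounds[OF that, of 0] block_branch_bounds[OF that, of 1]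
    by (auto simp: blocks.branch_def)
  then have unit: "0 \<le> y" "y \<le> 1" if "y \<in> blocks.attractor" for y
    using that blocks.coding_nonneg blocks.coding_le_1 by (auto simp: blocks.attractor_def)
  obtain k y where "k \<in> block_digits" "y \<in> blocks.attractor" "x = blocks.branch k y"
    using assms blocks.attractor_eq by blast
  then show "0 < x" "x \<le> 1" using block_branch_bounds unit by auto
qed

text \<open>For \<open>i < j\<close> the blocks of \<open>i\<close> and \<open>j\<close> both begin with \<open>i - 1\<close> digits \<open>u\<close>; the next digit is
  \<open>i\<close> in the first block and \<open>u\<close> in the second.\<close>

lemma block_branch_neq:
  assumes ij: "i \<in> block_digits" "j \<in> block_digits" "i < j"
    and "0 < x" "x \<le> 1" "0 < y" "y \<le> 1"
  shows "blocks.branch i x \<noteq> blocks.branch j y"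
proof
  let ?f = "digits.branch u"
  \<comment> \<open>The point \<open>z\<close> remains of \<open>blocks.branch j y\<close> after its first \<open>i\<close> digits, all equal to \<open>u\<close>.\<close>
  define z where "z = (?f ^^ (j - 1 - i)) (digits.branch j y)"
  have "0 < digits.branch j y" "digits.branch j y \<le> 1"
    using digit_branch_bounds[of j y] beta_nonneg[of j] assms by auto
  then have z: "0 < z" "z \<le> 1"
    using u_branches_bounds[of "digits.branch j y" "j - 1 - i"] by (auto simp: z_def)
  have "j - 1 = (i - 1) + Suc (j - 1 - i)" using ij by auto
  then have "blocks.branch j y = (?f ^^ (i - 1)) (?f z)"
    unfolding block_branch z_def by (metis comp_apply funpow.simps(2) funpow_add)
  moreover assume "blocks.branch i x = blocks.branch j y"
  ultimately have "(?f ^^ (i - 1)) (digits.branch i x) = (?f ^^ (i - 1)) (?f z)"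
    by (simp add: block_branch)
  moreover have "inj ?f"
    using p_pos[OF u_less] by (auto intro!: injI simp: digits.branch_def)
  ultimately have "digits.branch i x = ?f z" using inj_fn injD by metis
  then show False using digit_branch_neq[of i u x z] assms z u_less by auto
qed

sublocale blocks: separated_ifs block_digits block_offset block_ratio
proof
  fix i j assume ij: "i \<in> block_digits" "j \<in> block_digits" "i \<noteq> j"
  have "blocks.branch i x \<noteq> blocks.branch j y"
    if "x \<in> blocks.attractor" "y \<in> blocks.attractor" for x y
    using block_branch_neq[of i j x y] block_branch_neq[of j i y x] ij
      block_attractor_bounds[OF that(1)] block_attractor_bounds[OF that(2)]
    by (cases i j rule: linorder_cases) auto
  then show "blocks.branch i ` blocks.attractor \<inter> blocks.branch j ` blocks.attractor = {}" by blast
qed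

lemma flat_blocks_in_streams:
  assumes "w \<in> streams block_digits"
  shows "flat (smap (digit_block u) w) \<in> streams {..<s}"
proof -
  have "sset w \<subseteq> block_digits" using assms by (simp add: streams_iff_sset)
  moreover have "sset (flat (smap (digit_block u) w)) = (\<Union>k\<in>sset w. set (digit_block u k))"
    by (subst sset_flat) (auto simp: stream.set_map digit_block_def)
  ultimately show ?thesis
    using u_less by (auto simp: streams_iff_sset digit_block_def)
qed

lemma P_rep_block:
  assumes "a \<in> streams {..<s}" "k < s"
  shows "P_rep p (digit_block u k @- a) = blocks.branch k (P_rep p a)"
proof -
  have *: "replicate m u @- b \<in> streams {..<s} \<and>
    P_rep p (replicate m u @- b) = (digits.branch u ^^ m) (P_rep p b)"
    if "b \<in> streams {..<s}" for m b
    using that u_less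
    by (induction m) (simp_all add: P_rep_eq_coding digits.coding_unfold streams_Stream)
  have k: "k ## a \<in> streams {..<s}" using assms by (simp add: streams_Stream)
  then show ?thesis
    using *[OF k] digits.coding_unfold[OF k]
    by (simp add: digit_block_def block_branch P_rep_eq_coding)
qed

lemma P_rep_flat_blocks:
  assumes "w \<in> streams block_digits"
  shows "P_rep p (flat (smap (digit_block u) w)) = blocks.coding w"
proof -
  obtain M where M: "\<And>x. x \<in> digits.attractor \<Longrightarrow> \<bar>x\<bar> \<le> M"
    using digits.bounded_attractor by (auto simp: bounded_real)
  show ?thesis
  proof (rule blocks.coding_eqI[OF assms])
    fix v assume v: "v \<in> streams block_digits"
    show "\<bar>P_rep p (flat (smap (digit_block u) v))\<bar> \<le> M"
      using M flat_blocks_in_streams[OF v] by (simp add: P_rep_eq_coding digits.attractor_def)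
    have "flat (smap (digit_block u) v)
        = digit_block u (shd v) @- flat (smap (digit_block u) (stl v))"
      by (subst flat_unfold) (simp_all add: digit_block_def)
    then show "P_rep p (flat (smap (digit_block u) v))
        = blocks.branch (shd v) (P_rep p (flat (smap (digit_block u) (stl v))))"
      using P_rep_block flat_blocks_in_streams[OF streams_stl[OF v]] streams_shd[OF v] by simp
  qed
qed

lemma S_set_eq_attractor: "S_set s p u = blocks.attractor"
proof -
  have "S_set s p u = (\<lambda>w. P_rep p (flat (smap (digit_block u) w))) ` streams block_digits"
    unfolding S_set_def block_digits_def by blast
  also have "\<dots> = blocks.attractor"
    unfolding blocks.attractor_def using P_rep_flat_blocks by (intro image_cong) auto
  finally show ?thesis .
qed

end

theorem theorem4:
  fixes s u :: nat and p :: "nat \<Rightarrow> real"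
  assumes "s > 2"
    and "\<And>i. i < s \<Longrightarrow> p i > 0"
    and "(\<Sum>i<s. p i) = 1"
    and "u < s"
  shows "self_similar_fractal (S_set s p u) \<and>
    (\<exists>\<alpha>\<^sub>0::real. \<alpha>\<^sub>0 \<ge> 0 \<and> hausdorff_dim (S_set s p u) = ennreal \<alpha>\<^sub>0 \<and>
      (\<Sum>i\<in>{1..<s} - {u}. (p i * p u ^ (i - 1)) powr \<alpha>\<^sub>0) = 1)"
proof -
  interpret digit_expansion s u p using assms by unfold_locales
  obtain a where a: "0 \<le> a" "(\<Sum>i\<in>block_digits. block_ratio i powr a) = 1"
    by (rule blocks.similarity_exponent_exists)
  have "hausdorff_dim (S_set s p u) = ennreal a"
    unfolding S_set_eq_attractor using a by (rule blocks.hausdorff_dim_attractor)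
  moreover have "self_similar_fractal (S_set s p u)"
    unfolding S_set_eq_attractor by (rule blocks.self_similar_fractal_attractor)
  ultimately show ?thesis using a by (auto simp: block_ratio_def block_digits_def)
qed

end
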